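(* Let $G$ be a finite Abelian group, let $H\le G$ be the hidden subgroup in an instance of the finite Abelian hidden subgroup problem on $G$, and let $0<\epsilon<1$. Suppose the standard quantum algorithm is run for $k$ iterations, producing independent uniformly random elements $\mathbf{t}_1,\ldots,\mathbf{t}_k$ of $H^{\perp}$, and outputs the solution subgroup $A=\{\mathbf{x}\in G : \sum_{j=1}^{l} t_{ij}x_j/N_j\in\mathbb{Z}\ \text{for all } i=1,\ldots,k\}$. If $$k\ge \operatorname{rank}(G)+\left\lceil\log_2\frac{2}{\epsilon}\right\rceil\quad\text{or}\quad k\ge \operatorname{len}(G)-\operatorname{len}(H)+\left\lceil\log_2\frac{1}{\epsilon}\right\rceil,$$ then the algorithm succeeds, i.e. $A=H$, with probability at least $1-\epsilon$.
   Context: Hidden subgroup problem: given a black-box function $f:G\to S$ ($S$ a finite set) such that for an unknown subgroup $H\le G$ one has $f(x)=f(y)$ if and only if $xH=yH$, identify $H$. In the finite Abelian case, fix a decomposition $G\cong \mathbb{Z}/N_1\mathbb{Z}\oplus\cdots\oplus\mathbb{Z}/N_l\mathbb{Z}$ with each $N_i$ a prime power, and write elements of $G$ as tuples $x=(x_1,\ldots,x_l)$ with $x_i\in\{0,\ldots,N_i-1\}$. The orthogonal subgroup of $H\le G$ is $H^{\perp}=\{t\in G : \sum_{i=1}^{l} t_i s_i/N_i\in\mathbb{Z}\ \text{for all } s\in H\}$. The standard quantum algorithm is the following: its $i$-th iteration returns an element $\mathbf{t}_i=(t_{i1},\ldots,t_{il})$ distributed uniformly on $H^{\perp}$, with the iterations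 independent (this is the known property of the algorithm that is taken as given); after $k$ iterations it solves the linear congruence system defining $A$ and outputs $A$. $\operatorname{rank}(G)$ is the minimal cardinality of a generating set of $G$. $\operatorname{len}(G)$, the chain length of $G$, is the length of any composition series of $G$ (the trivial group has length $0$). *)

theory Defs
  imports
    "HOL-Algebra.Elementary_Groups"
    "HOL-Algebra.Product_Groups"
    "HOL-Algebra.Generated_Groups"
    "HOL-Algebra.SimpleGroups"
    "HOL-Number_Theory.Prime_Powers"
    "HOL-Probability.Probability"
begin

definition hides_subgroup ::
    "('a, 'b) monoid_scheme \<Rightarrow> 'a set \<Rightarrow> 's set \<Rightarrow> ('a \<Rightarrow> 's) \<Rightarrow> bool" where
  "hides_subgroup G H S f \<longleftrightarrow>
     subgroup H G \<and> finite S \<and> f \<in> carrier G \<rightarrow> S \<and>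
     (\<forall>x\<in>carrier G. \<forall>y\<in>carrier G. f x = f y \<longleftrightarrow> x <#\<^bsub>G\<^esub> H = y <#\<^bsub>G\<^esub> H)"

text \<open>
  The isomorphism \<open>\<phi>\<close> sends a group element to its coordinate tuple, whose \<open>i\<close>-th entry is an
  integer in \<open>{0..<N i}\<close>. A direct sum with \<open>l = 0\<close> summands is the trivial group.
\<close>

definition prime_power_decomposition ::
    "('a, 'b) monoid_scheme \<Rightarrow> nat \<Rightarrow> (nat \<Rightarrow> nat) \<Rightarrow> ('a \<Rightarrow> nat \<Rightarrow> int) \<Rightarrow> bool" where
  "prime_power_decomposition G l N \<phi> \<longleftrightarrow>
     (\<forall>i\<in>{1..l}. primepow (N i)) \<and>
     \<phi> \<in> iso G (product_group {1..l} (\<lambda>i. integer_mod_group (N i)))"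

definition coord_pairing :: "nat \<Rightarrow> (nat \<Rightarrow> nat) \<Rightarrow> (nat \<Rightarrow> int) \<Rightarrow> (nat \<Rightarrow> int) \<Rightarrow> real" where
  "coord_pairing l N t s = (\<Sum>i=1..l. real_of_int (t i) * real_of_int (s i) / real (N i))"

definition orthogonal_subgroup ::
    "('a, 'b) monoid_scheme \<Rightarrow> nat \<Rightarrow> (nat \<Rightarrow> nat) \<Rightarrow> ('a \<Rightarrow> nat \<Rightarrow> int) \<Rightarrow> 'a set \<Rightarrow> 'a set" where
  "orthogonal_subgroup G l N \<phi> H =
     {t \<in> carrier G. \<forall>s\<in>H. coord_pairing l N (\<phi> t) (\<phi> s) \<in> \<int>}"

definition solution_subgroup ::
    "('a, 'b) monoid_scheme \<Rightarrow> nat \<Rightarrow> (nat \<Rightarrow> nat) \<Rightarrow> ('a \<Rightarrow> nat \<Rightarrow> int) \<Rightarrow>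
     nat \<Rightarrow> (nat \<Rightarrow> 'a) \<Rightarrow> 'a set" where
  "solution_subgroup G l N \<phi> k t =
     {x \<in> carrier G. \<forall>i\<in>{1..k}. coord_pairing l N (\<phi> (t i)) (\<phi> x) \<in> \<int>}"

text \<open>
  Meaningful for finitely generated groups only, in particular for finite ones.
\<close>

definition group_rank :: "('a, 'b) monoid_scheme \<Rightarrow> nat" where
  "group_rank G =
     (LEAST n. \<exists>X. X \<subseteq> carrier G \<and> finite X \<and> card X = n \<and> generate G X = carrier G)"

definition composition_series :: "('a, 'b) monoid_scheme \<Rightarrow> 'a set list \<Rightarrow> bool" where
  "composition_series G Hs \<longleftrightarrow>
     Hs \<noteq> [] \<and> hd Hs = {\<one>\<^bsub>G\<^esub>} \<and> last Hs = carrier G \<and>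
     (\<forall>K\<in>set Hs. subgroup K G) \<and>
     (\<forall>i. Suc i < length Hs \<longrightarrow>
        (Hs ! i) \<lhd> (G\<lparr>carrier := Hs ! Suc i\<rparr>) \<and>
        simple_group (G\<lparr>carrier := Hs ! Suc i\<rparr> Mod (Hs ! i)))"

text \<open>
  The length of a composition series is its number of factors, one less than its number of
  terms. By the Jordan-Hoelder theorem it does not depend on the series; every finite group has
  a composition series, so the description below is well-defined for finite groups.
\<close>

definition chain_length :: "('a, 'b) monoid_scheme \<Rightarrow> nat" where
  "chain_length G = (THE n. \<exists>Hs. composition_series G Hs \<and> length Hs = Suc n)"

end

theory Submission
  imports Defs "HOL-Algebra.Multiplicative_Group"
begin

text \<open>
  The output \<open>A\<close> contains \<open>H\<close> almost surely, and \<open>A \<noteq> H\<close> forces some prime \<open>p\<close> and some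
  \<open>x \<in> A - H\<close> with \<open>x\<^sup>p \<in> H\<close>. For such an \<open>x\<close> the elements of \<open>H\<^sup>\<bottom>\<close> orthogonal to \<open>x\<close> form a
  subgroup of index \<open>p\<close>, so \<open>x \<in> A\<close> has probability \<open>p\<^sup>-\<^sup>k\<close>. Let \<open>p\<^sup>r\<close> be the number of
  cosets \<open>x H\<close> with \<open>x\<^sup>p \<in> H\<close>. As \<open>A\<close> then contains at least \<open>p - 1\<close> of the nontrivial ones, Markov's
  inequality bounds the failure at \<open>p\<close> by \<open>(p\<^sup>r - 1) / ((p - 1) p\<^sup>k) = (\<Sum>j<r. p\<^sup>j) / p\<^sup>k\<close>.

  The first bound on \<open>k\<close> uses \<open>r \<le> rank G\<close> and \<open>\<Sum>\<^sub>p 1 / (p (p - 1)) \<le> 1\<close>. The second one uses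
  that the exponents \<open>r\<close> for the different primes add up to at most the number of prime factors of
  \<open>|G| / |H|\<close>, which is the difference of the chain lengths.
\<close>

subsection \<open>Adjoining an element to a subgroup\<close>

context comm_group
begin

text \<open>In an abelian group this product is the subgroup generated by \<open>L\<close> and
  \<open>x\<close>. The product form exposes its elements as \<open>h \<otimes> x [^] k\<close> with
  \<open>h\<close> in \<open>L\<close> and an integer \<open>k\<close>.\<close>

definition adjoin :: "'a set \<Rightarrow> 'a \<Rightarrow> 'a set" where
  "adjoin L x = L <#> generate G {x}"

lemma subgroup_nat_pow_closed:
  assumes "subgroup L G" "x \<in> L"
  shows "x [^] (n::nat) \<in> L"
  using subgroup_int_pow_closed[OF assms, of "int n"] by (simp add: int_pow_int)

lemma subgroup_adjoin:
  assumes "subgroup L G" "x \<in> carrier G"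
  shows "subgroup (adjoin L x) G"
  unfolding adjoin_def using assms by (intro mult_subgroups generate_is_subgroup) auto

lemma adjoin_subset:
  assumes "subgroup L G" "subgroup M G" "L \<subseteq> M" "x \<in> M"
  shows "adjoin L x \<subseteq> M"
proof -
  have "generate G {x} \<subseteq> M"
    using assms by (intro generate_subgroup_incl) auto
  then show ?thesis
    unfolding adjoin_def set_mult_def using assms subgroup.m_closed[OF assms(2)] by blast
qed

lemma subset_adjoin:
  assumes "subgroup L G" "x \<in> carrier G"
  shows "L \<subseteq> adjoin L x"
proof
  fix h assume "h \<in> L"
  then have "h = h \<otimes> \<one>" using subgroup.mem_carrier[OF assms(1)] by simp
  then show "h \<in> adjoin L x"
    unfolding adjoin_def set_mult_def using \<open>h \<in> L\<close> generate.one by blast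
qed

lemma mem_adjoin:
  assumes "subgroup L G" "x \<in> carrier G"
  shows "x \<in> adjoin L x"
proof -
  have "x = \<one> \<otimes> x" using assms by simp
  then show ?thesis
    unfolding adjoin_def set_mult_def using subgroup.one_closed[OF assms(1)] generate.incl[of x "{x}" G]
    by blast
qed

text \<open>Division with remainder on the exponent: its multiple of \<open>p\<close> contributes a
  power of \<open>x [^] p\<close>, which \<open>L\<close> absorbs.\<close>

lemma adjoin_eq:
  assumes L: "subgroup L G" and x: "x \<in> carrier G" and xp: "x [^] p \<in> L" and p: "p > (0::nat)"
  shows "adjoin L x = (\<lambda>(h, j). h \<otimes> x [^] j) ` (L \<times> {..<p})"
proof
  show "(\<lambda>(h, j). h \<otimes> x [^] j) ` (L \<times> {..<p}) \<subseteq> adjoin L x"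
    using subset_adjoin[OF L x] mem_adjoin[OF L x] subgroup_adjoin[OF L x]
    by (auto intro!: subgroup.m_closed[OF subgroup_adjoin[OF L x]] subgroup_nat_pow_closed)
  show "adjoin L x \<subseteq> (\<lambda>(h, j). h \<otimes> x [^] j) ` (L \<times> {..<p})"
  proof
    fix y assume "y \<in> adjoin L x"
    then obtain h and k :: int where h: "h \<in> L" and y: "y = h \<otimes> x [^] k"
      by (auto simp: adjoin_def set_mult_def generate_pow[OF x])
    have hc: "h \<in> carrier G" by (rule subgroup.mem_carrier[OF L h])
    define h' where "h' = (x [^] p) [^] (k div int p)"
    have "h' \<in> L" unfolding h'_def by (rule subgroup_int_pow_closed[OF L xp])
    then have hc': "h' \<in> carrier G" by (rule subgroup.mem_carrier[OF L])
    have "x [^] k = x [^] (int p * (k div int p) + k mod int p)" by simp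
    also have "\<dots> = h' \<otimes> x [^] (k mod int p)"
      using x unfolding h'_def by (subst int_pow_mult) (simp_all add: int_pow_pow flip: int_pow_int)
    also have "x [^] (k mod int p) = x [^] nat (k mod int p)"
      using p by (simp flip: int_pow_int)
    finally have "y = (h \<otimes> h') \<otimes> x [^] nat (k mod int p)"
      using y hc hc' x by (simp add: m_assoc)
    moreover have "h \<otimes> h' \<in> L" using h \<open>h' \<in> L\<close> L by (simp add: subgroup.m_closed)
    moreover have "nat (k mod int p) < p" using p by (simp add: nat_less_iff)
    ultimately show "y \<in> (\<lambda>(h, j). h \<otimes> x [^] j) ` (L \<times> {..<p})" by force
  qed
qed

lemma card_adjoin_le:
  assumes "finite (carrier G)" "subgroup L G" "x \<in> carrier G" "x [^] p \<in> L" "p > (0::nat)"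
  shows "card (adjoin L x) \<le> p * card L"
proof -
  have "finite L" using assms subgroup.subset finite_subset by metis
  then have "card (adjoin L x) \<le> card (L \<times> {..<p})"
    unfolding adjoin_eq[OF assms(2-5)] by (intro card_image_le) auto
  then show ?thesis by (simp add: card_cartesian_product mult.commute)
qed

text \<open>Bezout: an integer combination of \<open>m\<close> and \<open>n\<close> equals 1, so
  \<open>x\<close> is a product of powers of the two given elements of \<open>L\<close>.\<close>

lemma subgroup_pow_coprime:
  assumes L: "subgroup L G" and x: "x \<in> carrier G"
    and "x [^] m \<in> L" "x [^] n \<in> L" "coprime m (n::nat)"
  shows "x \<in> L"
proof -
  obtain u v where uv: "u * int m + v * int n = 1"
    using \<open>coprime m n\<close> bezout_int[of "int m" "int n"] by auto
  have "x = x [^] (int m * u + int n * v)" using uv x by (simp add: mult.commute int_pow_1)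
  also have "\<dots> = (x [^] m) [^] u \<otimes> (x [^] n) [^] v"
    using x by (simp add: int_pow_mult int_pow_pow flip: int_pow_int)
  also have "\<dots> \<in> L"
    using assms by (intro subgroup.m_closed[OF L] subgroup_int_pow_closed[OF L])
  finally show ?thesis .
qed

text \<open>Two coinciding products with exponents \<open>i < j < p\<close> would put
  \<open>x [^] (j - i)\<close> into \<open>L\<close>. As \<open>j - i\<close> is coprime to
  \<open>p\<close>, \<open>x\<close> itself would then lie in \<open>L\<close>. So the
  parametrisation in \<open>adjoin_eq\<close> is injective.\<close>

lemma card_adjoin:
  assumes fin: "finite (carrier G)" and L: "subgroup L G" and x: "x \<in> carrier G"
    and p: "prime (p::nat)" and xp: "x [^] p \<in> L" and xL: "x \<notin> L"
  shows "card (adjoin L x) = p * card L"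
proof -
  note Lc = subgroup.mem_carrier[OF L]
  have eq: "i = j" if "h \<in> L" "h' \<in> L" "i \<le> j" "j < p" "h \<otimes> x [^] i = h' \<otimes> x [^] j" for h h' i j
  proof (rule ccontr)
    assume "i \<noteq> j"
    have hc: "h \<in> carrier G" "h' \<in> carrier G" using that Lc by simp_all
    have "h \<otimes> x [^] i = h' \<otimes> (x [^] (j - i) \<otimes> x [^] i)"
      using that(3,5) x by (simp add: nat_pow_mult)
    also have "\<dots> = h' \<otimes> x [^] (j - i) \<otimes> x [^] i"
      using hc x by (simp add: m_assoc)
    finally have "h = h' \<otimes> x [^] (j - i)"
      using hc x by simp
    then have "x [^] (j - i) = inv h' \<otimes> h"
      using hc x by (simp add: inv_solve_left)
    then have "x [^] (j - i) \<in> L"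
      using that(1,2) L by (simp add: subgroup.m_closed subgroup.m_inv_closed)
    moreover have "coprime p (j - i)"
      using p \<open>i \<noteq> j\<close> that by (intro prime_imp_coprime) (auto dest: dvd_imp_le)
    ultimately show False using subgroup_pow_coprime[OF L x xp] xL by blast
  qed
  have "inj_on (\<lambda>(h, j). h \<otimes> x [^] j) (L \<times> {..<p})"
  proof (rule inj_onI, clarify)
    fix h i h' j assume *: "h \<in> L" "i < p" "h' \<in> L" "j < p" "h \<otimes> x [^] i = h' \<otimes> x [^] j"
    then have "i = j" using eq[of h h' i j] eq[of h' h j i] by (cases "i \<le> j") auto
    then show "h = h' \<and> i = j" using * x Lc by simp
  qed
  then show ?thesis
    unfolding adjoin_eq[OF L x xp prime_gt_0_nat[OF p]]
    by (simp add: card_image card_cartesian_product mult.commute)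
qed

text \<open>Take the least positive \<open>n\<close> with \<open>y [^] n\<close> in \<open>L\<close>
  and split a prime off it, \<open>n = m * p\<close>. Then \<open>x = y [^] m\<close> works, since
  \<open>m < n\<close> keeps it outside \<open>L\<close>.\<close>

lemma exists_prime_pow_mem:
  assumes fin: "finite (carrier G)" and L: "subgroup L G" and M: "subgroup M G"
    and y: "y \<in> M" "y \<notin> L"
  obtains p x where "prime (p::nat)" "x \<in> M" "x \<notin> L" "x [^] p \<in> L"
proof -
  have yc: "y \<in> carrier G" by (rule subgroup.mem_carrier[OF M y(1)])
  define n where "n = (LEAST n::nat. n > 0 \<and> y [^] n \<in> L)"
  have "Coset.order G > 0 \<and> y [^] Coset.order G \<in> L"
    using pow_order_eq_1[OF yc] subgroup.one_closed[OF L] fin by (simp add: order_gt_0_iff_finite)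
  then have n: "n > 0 \<and> y [^] n \<in> L" unfolding n_def by (rule LeastI)
  have least: "n \<le> m" if "m > 0 \<and> y [^] m \<in> L" for m
    using that unfolding n_def by (rule Least_le)
  have "n \<noteq> 1" using n y yc by auto
  then obtain p where p: "prime p" "p dvd n" using prime_factor_nat by blast
  then obtain m where m: "n = m * p" by (metis dvd_def mult.commute)
  with n p have "m > 0" "m < n" using prime_gt_1_nat[of p] by auto
  show thesis
  proof
    show "prime p" by fact
    show "y [^] m \<in> M" using y M by (simp add: subgroup_nat_pow_closed)
    show "y [^] m \<notin> L" using least[of m] \<open>m > 0\<close> \<open>m < n\<close> by auto
    show "(y [^] m) [^] p \<in> L" using n yc m by (simp add: nat_pow_pow)
  qed
qed

text \<open>Nested subgroups are joined by a chain of steps of prime index: while \<open>K\<close>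
  is smaller than \<open>M\<close>, \<open>exists_prime_pow_mem\<close> supplies the next element to
  adjoin. This drives the construction of composition series and the counting of roots and
  annihilators.\<close>

lemma subgroup_step_induct [consumes 4, case_names base step]:
  assumes fin: "finite (carrier G)" and L: "subgroup L G" and M: "subgroup M G" and sub: "L \<subseteq> M"
    and base: "P L"
    and step: "\<And>K x p. \<lbrakk>subgroup K G; L \<subseteq> K; K \<subseteq> M; P K; prime (p::nat); x \<in> M; x \<notin> K; x [^] p \<in> K\<rbrakk>
                 \<Longrightarrow> P (adjoin K x)"
  shows "P M"
proof -
  have finM: "finite M" using fin M subgroup.subset finite_subset by metis
  have "P M" if "subgroup K G" "L \<subseteq> K" "K \<subseteq> M" "P K" for K
    using that
  proof (induction "card M - card K" arbitrary: K rule: less_induct)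
    case less
    show ?case
    proof (cases "K = M")
      case False
      then obtain y where "y \<in> M" "y \<notin> K" using less by blast
      then obtain p :: nat and x where x: "prime p" "x \<in> M" "x \<notin> K" "x [^] p \<in> K"
        by (rule exists_prime_pow_mem[OF fin \<open>subgroup K G\<close> M])
      have xc: "x \<in> carrier G" by (rule subgroup.mem_carrier[OF M x(2)])
      have sub': "adjoin K x \<subseteq> M" by (rule adjoin_subset[OF \<open>subgroup K G\<close> M \<open>K \<subseteq> M\<close> x(2)])
      have "K \<subset> adjoin K x"
        using subset_adjoin[OF \<open>subgroup K G\<close> xc] mem_adjoin[OF \<open>subgroup K G\<close> xc] x by blast
      then have "card K < card (adjoin K x)"
        using finite_subset[OF sub' finM] by (intro psubset_card_mono)
      moreover have "card (adjoin K x) \<le> card M" using sub' finM by (intro card_mono)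
      ultimately have "card M - card (adjoin K x) < card M - card K" by linarith
      then show ?thesis
      proof (rule less.hyps)
        show "subgroup (adjoin K x) G" by (rule subgroup_adjoin[OF \<open>subgroup K G\<close> xc])
        show "L \<subseteq> adjoin K x" using less.prems(2) \<open>K \<subset> adjoin K x\<close> by order
        show "P (adjoin K x)" by (rule step[OF less.prems x])
      qed (rule sub')
    qed (use less in simp)
  qed
  from this[OF L order.refl sub base] show ?thesis .
qed

lemma card_subgroup_pos:
  assumes "finite (carrier G)" "subgroup L G"
  shows "card L > 0"
  by (rule subgroup.finite_imp_card_positive[OF assms(2,1)])

lemma card_subgroup_dvd_order:
  assumes "finite (carrier G)" "subgroup L G"
  shows "card L dvd Coset.order G"
  using lagrange_finite[OF assms] by (metis dvd_triv_right)

end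

subsection \<open>Composition series of finite abelian groups\<close>

text \<open>There is an element of prime order, and the cyclic subgroup it generates is normal and
  nontrivial, hence everything.\<close>

lemma simple_comm_group_order_prime:
  assumes "simple_group Q" "comm_group Q"
  shows "prime (Coset.order Q)"
proof -
  interpret simple_group Q by fact
  interpret comm_group Q by fact
  \<comment> \<open>An infinite carrier would have order 0, since \<open>card\<close> is 0 on
    infinite sets.\<close>
  have fin: "finite (carrier Q)"
    using order_gt_one order_gt_0_iff_finite by simp
  obtain y where y: "y \<in> carrier Q" "y \<notin> {\<one>\<^bsub>Q\<^esub>}"
    using simple_not_triv one_closed by blast
  obtain p :: nat and x where px: "prime p" "x \<in> carrier Q" "x \<notin> {\<one>\<^bsub>Q\<^esub>}" "x [^]\<^bsub>Q\<^esub> p \<in> {\<one>\<^bsub>Q\<^esub>}"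
    by (rule exists_prime_pow_mem[OF fin triv_subgroup subgroup_self y])
  have "adjoin {\<one>\<^bsub>Q\<^esub>} x \<lhd> Q"
    by (intro subgroup_imp_normal subgroup_adjoin triv_subgroup px)
  moreover have "adjoin {\<one>\<^bsub>Q\<^esub>} x \<noteq> {\<one>\<^bsub>Q\<^esub>}"
    using mem_adjoin[OF triv_subgroup px(2)] px(3) by auto
  ultimately have "adjoin {\<one>\<^bsub>Q\<^esub>} x = carrier Q"
    using no_real_normal_subgroup by blast
  then show ?thesis
    using card_adjoin[OF fin triv_subgroup px(2,1,4,3)] px(1) by (simp add: Coset.order_def)
qed

context comm_group
begin

lemma subgroup_imp_comm_group:
  assumes L: "subgroup L G"
  shows "comm_group (G\<lparr>carrier := L\<rparr>)"
proof (rule group.group_comm_groupI)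
  show "group (G\<lparr>carrier := L\<rparr>)" by (rule subgroup_imp_group[OF L])
qed (simp add: m_comm subgroup.mem_carrier[OF L])

lemma comm_group_FactGroup_carrier_update:
  assumes K: "subgroup K G" and L: "subgroup L G" and sub: "K \<subseteq> L"
  shows "K \<lhd> (G\<lparr>carrier := L\<rparr>)" "comm_group (G\<lparr>carrier := L\<rparr> Mod K)"
    "finite (carrier G) \<Longrightarrow> card L = card K * Coset.order (G\<lparr>carrier := L\<rparr> Mod K)"
proof -
  interpret L: comm_group "G\<lparr>carrier := L\<rparr>" 
    using subgroup_imp_comm_group[OF L] .
  have sg: "subgroup K (G\<lparr>carrier := L\<rparr>)" by (rule subgroup_incl[OF K L sub])
  show "K \<lhd> (G\<lparr>carrier := L\<rparr>)" by (rule L.subgroup_imp_normal[OF sg])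
  show "comm_group (G\<lparr>carrier := L\<rparr> Mod K)" by (rule L.abelian_FactGroup[OF sg])
  assume "finite (carrier G)"
  then have "finite (carrier (G\<lparr>carrier := L\<rparr>))"
    using L subgroup.subset finite_subset by fastforce
  from L.lagrange_finite[OF this sg]
  show "card L = card K * Coset.order (G\<lparr>carrier := L\<rparr> Mod K)"
    by (simp add: Coset.order_def FactGroup_def mult.commute)
qed

text \<open>Every factor is simple and abelian, hence of prime order, so the order of the
  \<open>i\<close>-th term has exactly \<open>i\<close> prime factors with multiplicity. The length
  is thereby independent of the series without an appeal to Jordan-Hoelder.\<close>

lemma length_composition_series:
  assumes fin: "finite (carrier G)" and cs: "composition_series G Hs"
  shows "length Hs = Suc (size (prime_factorization (Coset.order G)))"
proof -
  have ne: "Hs \<noteq> []" and hd: "Hs ! 0 = {\<one>}" and la: "Hs ! (length Hs - 1) = carrier G"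
    using cs by (auto simp: composition_series_def hd_conv_nth last_conv_nth)
  have "size (prime_factorization (card (Hs ! i))) = i" if "i < length Hs" for i
    using that
  proof (induction i)
    case 0
    then show ?case by (simp add: hd)
  next
    case (Suc i)
    let ?Q = "G\<lparr>carrier := Hs ! Suc i\<rparr> Mod (Hs ! i)"
    have sg: "subgroup (Hs ! i) G" "subgroup (Hs ! Suc i) G"
      and nor: "(Hs ! i) \<lhd> (G\<lparr>carrier := Hs ! Suc i\<rparr>)" and simple: "simple_group ?Q"
      using cs Suc.prems by (auto simp: composition_series_def)
    have sub: "Hs ! i \<subseteq> Hs ! Suc i"
      using subgroup.subset[OF normal_imp_subgroup[OF nor]] by simp
    note facts = comm_group_FactGroup_carrier_update[OF sg sub]
    have "prime (Coset.order ?Q)"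
      by (rule simple_comm_group_order_prime[OF simple facts(2)])
    then show ?case
      using Suc card_subgroup_pos[OF fin sg(1)]
      by (simp add: facts(3)[OF fin] prime_factorization_mult prime_factorization_prime)
  qed
  from this[of "length Hs - 1"] ne show ?thesis
    unfolding la Coset.order_def by (cases Hs) simp_all
qed

text \<open>Prime steps lead from the trivial subgroup to \<open>G\<close>, and each yields a factor
  of prime order, which is simple. The induction treats every intermediate \<open>K\<close> as a
  group of its own and appends \<open>adjoin K x\<close> to its series.\<close>

lemma exists_composition_series:
  assumes fin: "finite (carrier G)"
  shows "\<exists>Hs. composition_series G Hs"
proof -
  have subset_one: "{\<one>} \<subseteq> carrier G" by simp
  have "\<exists>Hs. composition_series (G\<lparr>carrier := carrier G\<rparr>) Hs"
    using fin triv_subgroup subgroup_self subset_one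
  proof (induction rule: subgroup_step_induct[where P = "\<lambda>K. \<exists>Hs. composition_series (G\<lparr>carrier := K\<rparr>) Hs"])
    case base
    have "composition_series (G\<lparr>carrier := {\<one>}\<rparr>) [{\<one>}]"
      using triv_subgroup subgroup_incl by (auto simp: composition_series_def)
    then show ?case by blast
  next
    case (step K x p)
    then obtain Hs where cs: "composition_series (G\<lparr>carrier := K\<rparr>) Hs" by blast
    define L where "L = adjoin K x"
    have L: "subgroup L G" and sub: "K \<subseteq> L"
      unfolding L_def using step by (auto intro: subgroup_adjoin subset_adjoin[THEN subsetD])
    note facts = comm_group_FactGroup_carrier_update[OF \<open>subgroup K G\<close> L sub]
    have "card L = p * card K" unfolding L_def using step by (intro card_adjoin fin)
    then have "Coset.order (G\<lparr>carrier := L\<rparr> Mod K) = p"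
      using facts(3)[OF fin] card_subgroup_pos[OF fin \<open>subgroup K G\<close>] by simp
    then have simple: "simple_group (G\<lparr>carrier := L\<rparr> Mod K)"
      using facts(2) step by (intro group.prime_order_simple) (auto simp: comm_group_def)
    have subL: "subgroup J (G\<lparr>carrier := L\<rparr>)" if "subgroup J (G\<lparr>carrier := K\<rparr>)" for J
      using that subgroup_incl[OF incl_subgroup[OF \<open>subgroup K G\<close> that] L]
        subgroup.subset[OF that] sub by auto
    have "composition_series (G\<lparr>carrier := L\<rparr>) (Hs @ [L])"
      unfolding composition_series_def
    proof (intro conjI allI impI ballI)
      fix J assume "J \<in> set (Hs @ [L])"
      then show "subgroup J (G\<lparr>carrier := L\<rparr>)"
        using cs subL subgroup_incl[OF L L] by (auto simp: composition_series_def)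
    next
      fix i assume "Suc i < length (Hs @ [L])"
      then consider "Suc i < length Hs" | "Suc i = length Hs" by fastforce
      then have "(Hs @ [L]) ! i \<lhd> (G\<lparr>carrier := (Hs @ [L]) ! Suc i\<rparr>) \<and>
        simple_group (G\<lparr>carrier := (Hs @ [L]) ! Suc i\<rparr> Mod (Hs @ [L]) ! i)"
      proof cases
        case 1
        then show ?thesis using cs by (simp add: composition_series_def nth_append)
      next
        case 2
        then have "(Hs @ [L]) ! Suc i = L" "(Hs @ [L]) ! i = K"
          using cs by (auto simp: composition_series_def nth_append last_conv_nth simp flip: 2)
        then show ?thesis using facts(1) simple by simp
      qed
      then show "(Hs @ [L]) ! i \<lhd> (G\<lparr>carrier := L, carrier := (Hs @ [L]) ! Suc i\<rparr>)"
        "simple_group (G\<lparr>carrier := L, carrier := (Hs @ [L]) ! Suc i\<rparr> Mod (Hs @ [L]) ! i)"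
        by simp_all
    qed (use cs in \<open>auto simp: composition_series_def\<close>)
    then show ?case unfolding L_def by blast
  qed
  then show ?thesis by simp
qed

lemma chain_length_eq:
  assumes fin: "finite (carrier G)"
  shows "chain_length G = size (prime_factorization (Coset.order G))"
  unfolding chain_length_def
  using exists_composition_series[OF fin] length_composition_series[OF fin]
  by (intro the_equality) auto

text \<open>The chain length counts prime factors with multiplicity, and this count is additive on
  the product of \<open>card H\<close> and the index.\<close>

lemma chain_length_diff:
  assumes fin: "finite (carrier G)" and H: "subgroup H G"
  shows "chain_length G = chain_length (G\<lparr>carrier := H\<rparr>)
           + size (prime_factorization (Coset.order G div card H))"
proof -
  interpret H: comm_group "G\<lparr>carrier := H\<rparr>" 
    using subgroup_imp_comm_group[OF H] .
  have "finite (carrier (G\<lparr>carrier := H\<rparr>))"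
    using H fin subgroup.subset finite_subset by fastforce
  from H.chain_length_eq[OF this]
  have eq: "chain_length (G\<lparr>carrier := H\<rparr>) = size (prime_factorization (card H))"
    by (simp add: Coset.order_def)
  obtain n where n: "Coset.order G = card H * n" using card_subgroup_dvd_order[OF fin H] by blast
  have "card H > 0" by (rule card_subgroup_pos[OF fin H])
  moreover have "Coset.order G > 0" using fin by (simp add: order_gt_0_iff_finite)
  ultimately show ?thesis
    unfolding eq chain_length_eq[OF fin] using n by (simp add: prime_factorization_mult)
qed

subsection \<open>The elements with \<open>p\<close>-th power in a subgroup\<close>

text \<open>For a subgroup \<open>H\<close> this is the preimage in \<open>G\<close> of the
  \<open>p\<close>-torsion of the quotient by \<open>H\<close>. For prime \<open>p\<close> that
  torsion is a vector space over the field with \<open>p\<close> elements, and its dimension is the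
  exponent \<open>r\<close> used below.\<close>

definition pth_roots :: "'a set \<Rightarrow> nat \<Rightarrow> 'a set" where
  "pth_roots H p = {x \<in> carrier G. x [^] p \<in> H}"

lemma subgroup_pth_roots:
  assumes H: "subgroup H G"
  shows "subgroup (pth_roots H p) G"
  unfolding pth_roots_def using subgroup.m_closed[OF H] subgroup.one_closed[OF H] subgroup.m_inv_closed[OF H]
  by (intro subgroupI) (auto simp: nat_pow_distrib nat_pow_inv)

lemma subset_pth_roots:
  assumes H: "subgroup H G"
  shows "H \<subseteq> pth_roots H p"
  unfolding pth_roots_def using subgroup_nat_pow_closed[OF H] subgroup.subset[OF H] by auto

lemma card_pth_roots:
  assumes fin: "finite (carrier G)" and H: "subgroup H G" and p: "prime p"
  shows "\<exists>r. card (pth_roots H p) = p ^ r * card H"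
  using fin H subgroup_pth_roots[OF H] subset_pth_roots[OF H]
proof (induction rule: subgroup_step_induct[where P = "\<lambda>K. \<exists>r. card K = p ^ r * card H"])
  case base
  show ?case by (rule exI[of _ 0]) simp
next
  case (step K x q)
  have xc: "x \<in> carrier G" and xp: "x [^] p \<in> K"
    using step by (auto simp: pth_roots_def)
  \<comment> \<open>All prime steps inside \<open>pth_roots H p\<close> use the same prime:
    \<open>x\<close> is outside \<open>K\<close> while \<open>x [^] p\<close> and
    \<open>x [^] q\<close> are both in it, which excludes coprime exponents.\<close>
  have "q = p"
    using subgroup_pow_coprime[OF \<open>subgroup K G\<close> xc xp \<open>x [^] q \<in> K\<close>] primes_coprime[OF p \<open>prime q\<close>]
      \<open>x \<notin> K\<close> by blast
  obtain r where "card K = p ^ r * card H" using step by blast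
  moreover have "card (adjoin K x) = p * card K"
    using step xc xp p by (intro card_adjoin fin)
  ultimately show ?case by (intro exI[of _ "Suc r"]) simp
qed

section \<open>Comparing the number of \<open>p\<close>-th roots with the rank of the group\<close>

lemma index_le_pow_generators:
  assumes fin: "finite (carrier G)" and P: "subgroup P G"
    and pw: "\<And>x. x \<in> carrier G \<Longrightarrow> x [^] p \<in> P" and p: "p > (0::nat)"
    and X: "X \<subseteq> carrier G" "finite X" "generate G X = carrier G"
  shows "Coset.order G \<le> p ^ card X * card P"
proof -
  \<comment> \<open>Adjoining the elements of \<open>Y\<close> to \<open>P\<close> one at a time
    multiplies the order by at most \<open>p\<close> each, as all \<open>p\<close>-th powers are
    already in \<open>P\<close>.\<close>
  have "\<exists>L. subgroup L G \<and> P \<subseteq> L \<and> Y \<subseteq> L \<and> card L \<le> p ^ card Y * card P"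
    if "finite Y" "Y \<subseteq> carrier G" for Y
    using that
  proof (induction Y rule: finite_induct)
    case empty
    show ?case using P by (intro exI[of _ P]) auto
  next
    case (insert y Y)
    then obtain L where L: "subgroup L G" "P \<subseteq> L" "Y \<subseteq> L" "card L \<le> p ^ card Y * card P"
      by auto
    have y: "y \<in> carrier G" using insert by simp
    have "card (adjoin L y) \<le> p * card L"
      using L pw[OF y] by (intro card_adjoin_le[OF fin L(1) y _ p]) blast
    also have "\<dots> \<le> p * (p ^ card Y * card P)" using L(4) by (rule mult_le_mono2)
    finally have "card (adjoin L y) \<le> p ^ card (insert y Y) * card P"
      using insert by simp
    then show ?case
      using L subset_adjoin[OF L(1) y] mem_adjoin[OF L(1) y] subgroup_adjoin[OF L(1) y]
      by (intro exI[of _ "adjoin L y"]) auto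
  qed
  from this[OF X(2,1)] obtain L where L: "subgroup L G" "X \<subseteq> L" "card L \<le> p ^ card X * card P"
    by auto
  have "carrier G \<subseteq> L" using generate_subgroup_incl[OF L(2,1)] X by simp
  then have "L = carrier G" using subgroup.subset[OF L(1)] by blast
  then show ?thesis using L(3) by (simp add: Coset.order_def)
qed

lemma group_rank_witness:
  assumes fin: "finite (carrier G)"
  obtains X where "X \<subseteq> carrier G" "finite X" "card X = group_rank G" "generate G X = carrier G"
proof -
  have gen: "generate G (carrier G) = carrier G"
    using generate_incl[of "carrier G"] generate.incl[of _ "carrier G" G] by blast
  have "\<exists>X. X \<subseteq> carrier G \<and> finite X \<and> card X = group_rank G \<and> generate G X = carrier G"
    unfolding group_rank_def
    by (rule LeastI[where k = "card (carrier G)"])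
      (intro exI[of _ "carrier G"] conjI fin gen order.refl refl)
  then show thesis using that by blast
qed

text \<open>Let \<open>P\<close> consist of the products of an element of \<open>H\<close> and a
  \<open>p\<close>-th power. On the quotient by \<open>H\<close>, the \<open>p\<close>-th power map
  has kernel \<open>pth_roots H p\<close> and image \<open>P\<close>, both modulo \<open>H\<close>.
  So \<open>card P * card (pth_roots H p)\<close> equals \<open>card H\<close> times the order of
  \<open>G\<close>; the proof establishes \<open>\<le>\<close>. As all \<open>p\<close>-th powers
  lie in \<open>P\<close>, its index is at most \<open>p ^ group_rank G\<close>.\<close>

lemma card_pth_roots_le_rank:
  assumes fin: "finite (carrier G)" and H: "subgroup H G" and p: "p > 0"
  shows "card (pth_roots H p) \<le> p ^ group_rank G * card H"
proof -
  note Hc = subgroup.mem_carrier[OF H]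
  let ?f = "\<lambda>(h, x). h \<otimes> x [^] p"
  define P where "P = ?f ` (H \<times> carrier G)"
  have P: "subgroup P G"
  proof (rule subgroupI)
    show "P \<subseteq> carrier G" using Hc by (auto simp: P_def)
    show "P \<noteq> {}" using subgroup.one_closed[OF H] by (auto simp: P_def)
  next
    fix a assume "a \<in> P"
    then obtain h x where hx: "h \<in> H" "x \<in> carrier G" and a: "a = h \<otimes> x [^] p"
      by (auto simp: P_def)
    have "inv a = ?f (inv h, inv x)"
      using hx Hc by (simp add: a inv_mult nat_pow_inv)
    moreover have "(inv h, inv x) \<in> H \<times> carrier G" using hx subgroup.m_inv_closed[OF H] by simp
    ultimately show "inv a \<in> P" unfolding P_def by blast
  next
    fix a b assume "a \<in> P" "b \<in> P"
    then obtain h x h' x' where hx: "h \<in> H" "x \<in> carrier G" "h' \<in> H" "x' \<in> carrier G"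
      and ab: "a = h \<otimes> x [^] p" "b = h' \<otimes> x' [^] p"
      by (auto simp: P_def)
    have "a \<otimes> b = ?f (h \<otimes> h', x \<otimes> x')"
      using hx Hc by (simp add: ab nat_pow_distrib m_ac)
    moreover have "(h \<otimes> h', x \<otimes> x') \<in> H \<times> carrier G" using hx subgroup.m_closed[OF H] by simp
    ultimately show "a \<otimes> b \<in> P" unfolding P_def by blast
  qed
  have finH: "finite H" using fin H subgroup.subset finite_subset by metis
  define s where "s = inv_into (H \<times> carrier G) ?f"
  have s: "s y \<in> H \<times> carrier G \<and> ?f (s y) = y" if "y \<in> P" for y
    using inv_into_into[OF that[unfolded P_def]] f_inv_into_f[OF that[unfolded P_def]]
    unfolding s_def by blast
  \<comment> \<open>\<open>s y\<close> is a chosen representation of \<open>y\<close>. Twisting it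
    by a root \<open>e\<close> represents the same \<open>y\<close>, since
    \<open>inv (e [^] p)\<close> and \<open>e [^] p\<close> cancel. Thus \<open>?f\<close> recovers
    \<open>y\<close>, and the second component then recovers \<open>e\<close>.\<close>
  let ?g = "\<lambda>(y, e). (fst (s y) \<otimes> inv (e [^] p), snd (s y) \<otimes> e)"
  have ec: "e \<in> carrier G" "e [^] p \<in> H" if "e \<in> pth_roots H p" for e
    using that by (auto simp: pth_roots_def)
  have s': "fst (s y) \<in> H" "snd (s y) \<in> carrier G" "fst (s y) \<otimes> snd (s y) [^] p = y"
    if "y \<in> P" for y
    using s[OF that] by (auto simp: case_prod_beta)
  have fg: "?f (?g (y, e)) = y" if "y \<in> P" "e \<in> pth_roots H p" for y e
  proof -
    let ?h = "fst (s y)" and ?x = "snd (s y)"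
    have "?f (?g (y, e)) = ?h \<otimes> inv (e [^] p) \<otimes> (?x [^] p \<otimes> e [^] p)"
      using s'[OF that(1)] ec[OF that(2)] by (simp add: nat_pow_distrib)
    also have "\<dots> = ?h \<otimes> ?x [^] p \<otimes> (inv (e [^] p) \<otimes> e [^] p)"
      using Hc[OF s'(1)[OF that(1)]] s'(2)[OF that(1)] ec(1)[OF that(2)]
      by (simp only: m_ac m_closed nat_pow_closed inv_closed)
    also have "\<dots> = y" using s'[OF that(1)] ec[OF that(2)] subgroup.mem_carrier[OF P that(1)] by simp
    finally show ?thesis .
  qed
  have inj: "inj_on ?g (P \<times> pth_roots H p)"
  proof (rule inj_onI, clarify)
    fix y e y' e' assume *: "y \<in> P" "e \<in> pth_roots H p" "y' \<in> P" "e' \<in> pth_roots H p"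
      and eq: "fst (s y) \<otimes> inv (e [^] p) = fst (s y') \<otimes> inv (e' [^] p)"
        "snd (s y) \<otimes> e = snd (s y') \<otimes> e'"
    then have "?f (?g (y, e)) = ?f (?g (y', e'))" by simp
    then have "y = y'" unfolding fg[OF *(1,2)] fg[OF *(3,4)] .
    then show "y = y' \<and> e = e'" using eq s'(2)[OF *(1)] ec(1)[OF *(2)] ec(1)[OF *(4)] by simp
  qed
  have "?g ` (P \<times> pth_roots H p) \<subseteq> H \<times> carrier G"
    using s' ec subgroup.m_closed[OF H] subgroup.m_inv_closed[OF H] by auto
  from card_inj_on_le[OF inj this]
  have 1: "card P * card (pth_roots H p) \<le> card H * Coset.order G"
    using finH fin by (simp add: card_cartesian_product Coset.order_def)
  obtain X where X: "X \<subseteq> carrier G" "finite X" "card X = group_rank G" "generate G X = carrier G"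
    by (rule group_rank_witness[OF fin])
  have "x [^] p \<in> P" if "x \<in> carrier G" for x
  proof -
    have "x [^] p = ?f (\<one>, x)" using that by simp
    moreover have "(\<one>, x) \<in> H \<times> carrier G" using that subgroup.one_closed[OF H] by simp
    ultimately show ?thesis unfolding P_def by blast
  qed
  from index_le_pow_generators[OF fin P this p X(1,2,4)]
  have "Coset.order G \<le> p ^ group_rank G * card P" by (simp add: X(3))
  then have "card H * Coset.order G \<le> card H * (p ^ group_rank G * card P)" by (rule mult_le_mono2)
  also have "\<dots> = card P * (p ^ group_rank G * card H)" by (simp only: mult_ac)
  finally have "card P * card (pth_roots H p) \<le> card P * (p ^ group_rank G * card H)"
    using 1 by (rule order.trans[rotated])
  then show ?thesis using card_subgroup_pos[OF fin P] by (rule mult_left_le_imp_le)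
qed

end

subsection \<open>Annihilators under a perfect pairing\<close>

lemma Ints_diff_cancel: "(u::real) - v \<in> \<int> \<Longrightarrow> u \<in> \<int> \<longleftrightarrow> v \<in> \<int>"
  by (metis Ints_diff Ints_add diff_add_cancel diff_diff_eq2 add_diff_cancel_left')

lemma card_le_sum_fibres:
  assumes "finite D" "\<And>t. t \<in> D \<Longrightarrow> f t \<in> C" "finite C" "\<And>c. c \<in> C \<Longrightarrow> card {t \<in> D. f t = c} \<le> n"
  shows "card D \<le> card C * n"
proof -
  have "D = (\<Union>c\<in>C. {t \<in> D. f t = c})" using assms by blast
  then have "card D \<le> (\<Sum>c\<in>C. card {t \<in> D. f t = c})"
    using card_UN_le[OF assms(3), of "\<lambda>c. {t \<in> D. f t = c}"] by metis
  also have "\<dots> \<le> card C * n" using sum_bounded_above[of C _ n] assms(4) by simp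
  finally show ?thesis .
qed

text \<open>Values are real numbers read modulo \<open>\<int>\<close>, so this is a symmetric
  nondegenerate pairing of \<open>G\<close> with itself into the circle group. Additivity in the
  second argument follows by symmetry.\<close>

locale finite_pairing = comm_group G for G (structure) +
  fixes b :: "'a \<Rightarrow> 'a \<Rightarrow> real"
  assumes fin: "finite (carrier G)"
    and pairing_sym: "b x y = b y x"
    and pairing_mult: "\<lbrakk>x \<in> carrier G; y \<in> carrier G; z \<in> carrier G\<rbrakk>
          \<Longrightarrow> b (x \<otimes> y) z - (b x z + b y z) \<in> \<int>"
    and pairing_nondegenerate: "\<lbrakk>x \<in> carrier G; \<forall>y\<in>carrier G. b x y \<in> \<int>\<rbrakk> \<Longrightarrow> x = \<one>"
begin

definition perp :: "'a set \<Rightarrow> 'a set" where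
  "perp L = {t \<in> carrier G. \<forall>s\<in>L. b t s \<in> \<int>}"

lemma pairing_one:
  assumes "z \<in> carrier G"
  shows "b \<one> z \<in> \<int>"
  using pairing_mult[of \<one> \<one> z] assms by simp

lemma pairing_mult_mem:
  assumes "x \<in> carrier G" "y \<in> carrier G" "z \<in> carrier G" "b x z \<in> \<int>" "b y z \<in> \<int>"
  shows "b (x \<otimes> y) z \<in> \<int>"
  using Ints_add[OF pairing_mult[OF assms(1-3)] Ints_add[OF assms(4,5)]] by simp

lemma pairing_inv:
  assumes "x \<in> carrier G" "z \<in> carrier G"
  shows "b (inv x) z + b x z \<in> \<int>"
proof -
  have "b (inv x \<otimes> x) z - (b (inv x) z + b x z) \<in> \<int>" "b (inv x \<otimes> x) z \<in> \<int>"
    using pairing_mult[of "inv x" x z] pairing_one assms by simp_all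
  then show ?thesis using Ints_diff_cancel by blast
qed

lemma pairing_inv_mem:
  assumes "x \<in> carrier G" "z \<in> carrier G" "b x z \<in> \<int>"
  shows "b (inv x) z \<in> \<int>"
  using Ints_diff[OF pairing_inv[OF assms(1,2)] assms(3)] by simp

lemma pairing_pow:
  assumes x: "x \<in> carrier G" and z: "z \<in> carrier G"
  shows "b (x [^] (n::nat)) z - n * b x z \<in> \<int>"
proof (induction n)
  case 0
  then show ?case using pairing_one[OF z] by simp
next
  case (Suc n)
  have "b (x [^] n \<otimes> x) z - (b (x [^] n) z + b x z) \<in> \<int>"
    using x z by (intro pairing_mult) auto
  from Ints_add[OF this Suc.IH] show ?case by (simp add: algebra_simps)
qed

text \<open>\<open>S\<close> is an arbitrary subset because the lemma serves annihilators of
  subgroups, of a single element and of the set of samples.\<close>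

lemma subgroup_annihilator:
  assumes "S \<subseteq> carrier G"
  shows "subgroup {t \<in> carrier G. \<forall>s\<in>S. b t s \<in> \<int>} G"
proof (rule subgroupI)
  show "{t \<in> carrier G. \<forall>s\<in>S. b t s \<in> \<int>} \<noteq> {}" using assms pairing_one by blast
qed (use assms in \<open>auto intro!: pairing_inv_mem pairing_mult_mem\<close>)

lemma subgroup_perp:
  assumes "L \<subseteq> carrier G"
  shows "subgroup (perp L) G"
  unfolding perp_def by (rule subgroup_annihilator[OF assms])

lemma perp_adjoin:
  assumes L: "subgroup L G" and x: "x \<in> carrier G"
  shows "perp (adjoin L x) = {t \<in> perp L. b t x \<in> \<int>}"
proof (intro equalityI subsetI)
  fix t assume "t \<in> perp (adjoin L x)"
  then show "t \<in> {t \<in> perp L. b t x \<in> \<int>}"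
    unfolding perp_def using mem_adjoin[OF L x] subset_adjoin[OF L x] by blast
next
  fix t assume t: "t \<in> {t \<in> perp L. b t x \<in> \<int>}"
  then have tc: "t \<in> carrier G" by (simp add: perp_def)
  \<comment> \<open>The elements orthogonal to this one \<open>t\<close> form a subgroup containing
    \<open>L\<close> and \<open>x\<close>, hence all of \<open>adjoin L x\<close>.\<close>
  let ?A = "{s \<in> carrier G. \<forall>t'\<in>{t}. b s t' \<in> \<int>}"
  have "adjoin L x \<subseteq> ?A"
  proof (rule adjoin_subset[OF L])
    show "subgroup ?A G" using tc by (intro subgroup_annihilator) simp
    show "L \<subseteq> ?A" using t subgroup.subset[OF L] by (auto simp: perp_def pairing_sym[of _ t])
    show "x \<in> ?A" using t x by (auto simp: pairing_sym[of _ t])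
  qed
  then show "t \<in> perp (adjoin L x)"
    using tc by (auto simp: perp_def pairing_sym[of _ t])
qed

text \<open>On \<open>perp L\<close> the number \<open>p * b t x\<close> is an integer, because it
  agrees with \<open>b t (x [^] p)\<close> modulo \<open>\<int>\<close>. So \<open>b t x\<close> has
  at most \<open>p\<close> values modulo \<open>\<int>\<close>, and elements with equal value differ
  by an element of \<open>perp (adjoin L x)\<close>.\<close>

lemma card_perp_adjoin_ge:
  assumes L: "subgroup L G" and x: "x \<in> carrier G" and xp: "x [^] p \<in> L" and p: "p > (0::nat)"
  shows "card (perp L) \<le> p * card (perp (adjoin L x))"
proof -
  \<comment> \<open>Encodes the class of \<open>b t x\<close> modulo \<open>\<int>\<close> as a
    residue modulo \<open>p\<close>; the floor loses nothing, its argument being an integer on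
    \<open>perp L\<close>.\<close>
  define \<phi> where "\<phi> t = \<lfloor>p * b t x\<rfloor> mod int p" for t
  have finp: "finite (perp K)" for K using fin by (simp add: perp_def)
  have "card {t \<in> perp L. \<phi> t = c} \<le> card (perp (adjoin L x))" for c
  proof (cases "{t \<in> perp L. \<phi> t = c} = {}")
    case False
    then obtain t1 where t1: "t1 \<in> perp L" "\<phi> t1 = c" by blast
    have t1c: "t1 \<in> carrier G" using t1 by (simp add: perp_def)
    have int: "p * b t x \<in> \<int>" if "t \<in> perp L" for t
    proof -
      have "t \<in> carrier G" "b t (x [^] p) \<in> \<int>" using that xp by (auto simp: perp_def)
      then show ?thesis
        using pairing_pow[OF x, of t p] Ints_diff_cancel by (metis pairing_sym)
    qed
    show ?thesis
    proof (rule card_inj_on_le[where f = "\<lambda>t. t \<otimes> inv t1"])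
      show "inj_on (\<lambda>t. t \<otimes> inv t1) {t \<in> perp L. \<phi> t = c}"
        using t1c by (auto simp: inj_on_def perp_def)
      show "(\<lambda>t. t \<otimes> inv t1) ` {t \<in> perp L. \<phi> t = c} \<subseteq> perp (adjoin L x)"
      proof clarify
        fix t assume t: "t \<in> perp L" "c = \<phi> t"
        have tc: "t \<in> carrier G" using t by (simp add: perp_def)
        have "\<lfloor>p * b t x\<rfloor> mod int p = \<lfloor>p * b t1 x\<rfloor> mod int p"
          using t t1 by (simp add: \<phi>_def)
        then obtain m where m: "\<lfloor>p * b t x\<rfloor> - \<lfloor>p * b t1 x\<rfloor> = int p * m"
          by (auto simp: mod_eq_dvd_iff)
        have fl: "of_int \<lfloor>p * b t x\<rfloor> = p * b t x" "of_int \<lfloor>p * b t1 x\<rfloor> = p * b t1 x"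
          using int[OF t(1)] int[OF t1(1)] by (auto elim!: Ints_cases)
        have "p * b t x - p * b t1 x = of_int (\<lfloor>p * b t x\<rfloor> - \<lfloor>p * b t1 x\<rfloor>)"
          by (simp only: of_int_diff fl)
        also have "\<dots> = p * of_int m" using m by simp
        finally have "real p * (b t x - b t1 x) = real p * of_int m" by (simp add: algebra_simps)
        then have d: "b t x - b t1 x \<in> \<int>" using p by simp
        have m': "b (t \<otimes> inv t1) x - (b t x + b (inv t1) x) \<in> \<int>"
          using tc t1c x by (intro pairing_mult) auto
        have "b (t \<otimes> inv t1) x \<in> \<int>"
          using Ints_add[OF Ints_add[OF m' pairing_inv[OF t1c x]] d] by simp
        moreover have "t \<otimes> inv t1 \<in> perp L"
          using t t1 subgroup_perp[OF subgroup.subset[OF L]]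
          by (simp add: subgroup.m_closed subgroup.m_inv_closed)
        ultimately show "t \<otimes> inv t1 \<in> perp (adjoin L x)" by (simp add: perp_adjoin[OF L x])
      qed
    qed (rule finp)
  qed (simp only: card.empty le0)
  from card_le_sum_fibres[where f = \<phi> and C = "{0..<int p}", OF finp _ _ this] p
  show ?thesis by (simp add: \<phi>_def)
qed

text \<open>
  Each prime step multiplies the order of a subgroup by \<open>p\<close> and divides that of its annihilator by
  at most \<open>p\<close>; at both ends of a chain from the trivial group to \<open>G\<close> the product is \<open>|G|\<close>.
\<close>

lemma card_perp_mono:
  assumes L: "subgroup L G" and M: "subgroup M G" and "L \<subseteq> M"
  shows "card (perp L) * card L \<le> card (perp M) * card M"
  using fin assms
proof (induction rule: subgroup_step_induct[where P = "\<lambda>K. card (perp L) * card L \<le> card (perp K) * card K"])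
  case (step K x p)
  have x: "x \<in> carrier G" by (rule subgroup.mem_carrier[OF M \<open>x \<in> M\<close>])
  have "card (perp K) * card K \<le> p * card (perp (adjoin K x)) * card K"
    using card_perp_adjoin_ge[OF \<open>subgroup K G\<close> x \<open>x [^] p \<in> K\<close>] prime_gt_0_nat[OF \<open>prime p\<close>]
    by (intro mult_le_mono1) 
  also have "\<dots> = card (perp (adjoin K x)) * card (adjoin K x)"
    using card_adjoin[OF fin \<open>subgroup K G\<close> x] step by simp
  finally show ?case using step by linarith
qed simp

lemma card_perp:
  assumes L: "subgroup L G"
  shows "card (perp L) * card L = Coset.order G"
proof (rule antisym)
  have "perp {\<one>} = carrier G" using pairing_one by (auto simp: perp_def pairing_sym[of _ \<one>])
  then show "Coset.order G \<le> card (perp L) * card L"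
    using card_perp_mono[OF triv_subgroup L] subgroup.one_closed[OF L]
    by (simp add: Coset.order_def)
  \<comment> \<open>Nondegeneracy fixes the value at the upper end of the chain.\<close>
  have "perp (carrier G) = {\<one>}"
    using pairing_one pairing_nondegenerate by (auto simp: perp_def)
  then show "card (perp L) * card L \<le> Coset.order G"
    using card_perp_mono[OF L subgroup_self] subgroup.subset[OF L] by (simp add: Coset.order_def)
qed

text \<open>By \<open>card_perp\<close> the product of the two orders is constant, so enlarging
  \<open>L\<close> by the factor \<open>p\<close> shrinks its annihilator by exactly
  \<open>p\<close>. Hence a uniform element of \<open>perp L\<close> annihilates \<open>x\<close>
  with probability \<open>1 / p\<close>.\<close>

lemma card_perp_adjoin:
  assumes L: "subgroup L G" and x: "x \<in> carrier G" "x \<notin> L" "x [^] p \<in> L" and p: "prime (p::nat)"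
  shows "p * card {t \<in> perp L. b t x \<in> \<int>} = card (perp L)"
proof -
  have "card (perp (adjoin L x)) * (p * card L) = card (perp L) * card L"
    using card_perp[OF L] card_perp[OF subgroup_adjoin[OF L x(1)]] card_adjoin[OF fin L x(1) p x(3,2)]
    by simp
  then show ?thesis using card_subgroup_pos[OF fin L] by (simp add: perp_adjoin[OF L x(1)] ac_simps)
qed

end

section \<open>The coordinate pairing of a prime power decomposition\<close>

lemma finite_pairing_coord:
  assumes G: "comm_group G" and fin: "finite (carrier G)"
    and dec: "prime_power_decomposition G l N \<phi>"
  shows "finite_pairing G (\<lambda>x y. coord_pairing l N (\<phi> x) (\<phi> y))"
proof -
  interpret comm_group G by fact
  let ?P = "product_group {1..l} (\<lambda>i. integer_mod_group (N i))"
  \<comment> \<open>This excludes the modulus 0, for which \<open>integer_mod_group\<close> is the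
    group of integers, and the modulus 1, for which the coordinate 1 of a unit vector would not be
    reduced.\<close>
  have N: "N i > 1" if "i \<in> {1..l}" for i
    using dec that primepow_gt_Suc_0 by (force simp: prime_power_decomposition_def)
  have iso: "\<phi> \<in> iso G ?P" using dec by (simp add: prime_power_decomposition_def)
  then have hom: "\<phi> \<in> hom G ?P" and bij: "bij_betw \<phi> (carrier G) (carrier ?P)"
    by (auto simp: iso_def)
  have mult: "\<phi> (x \<otimes>\<^bsub>G\<^esub> y) i = (\<phi> x i + \<phi> y i) mod int (N i)"
    if "x \<in> carrier G" "y \<in> carrier G" "i \<in> {1..l}" for x y i
    using hom_mult[OF hom that(1,2)] that(3) by simp
  show ?thesis
  proof (unfold_locales)
    show "finite (carrier G)" by fact
    show "coord_pairing l N (\<phi> x) (\<phi> y) = coord_pairing l N (\<phi> y) (\<phi> x)" for x y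
      by (simp add: coord_pairing_def mult.commute)
  next
    fix x y z assume xyz: "x \<in> carrier G" "y \<in> carrier G" "z \<in> carrier G"
    \<comment> \<open>Reducing a coordinate sum modulo \<open>N i\<close> subtracts a multiple of
      \<open>N i\<close>, which changes the \<open>i\<close>-th summand by an integer.\<close>
    have "coord_pairing l N (\<phi> (x \<otimes>\<^bsub>G\<^esub> y)) (\<phi> z)
        - (coord_pairing l N (\<phi> x) (\<phi> z) + coord_pairing l N (\<phi> y) (\<phi> z))
        = (\<Sum>i=1..l. real_of_int (- ((\<phi> x i + \<phi> y i) div int (N i)) * \<phi> z i))"
      unfolding coord_pairing_def sum.distrib[symmetric] sum_subtractf[symmetric]
    proof (rule sum.cong[OF refl])
      fix i assume i: "i \<in> {1..l}"
      let ?s = "\<phi> x i + \<phi> y i"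
      have "real_of_int ?s = real_of_int (int (N i) * (?s div int (N i)) + ?s mod int (N i))"
        by simp
      then have *: "real_of_int (?s mod int (N i)) = real_of_int ?s - N i * real_of_int (?s div int (N i))"
        by (simp only: of_int_add of_int_mult of_int_of_nat_eq)
      show "real_of_int (\<phi> (x \<otimes>\<^bsub>G\<^esub> y) i) * real_of_int (\<phi> z i) / real (N i)
          - (real_of_int (\<phi> x i) * real_of_int (\<phi> z i) / real (N i)
             + real_of_int (\<phi> y i) * real_of_int (\<phi> z i) / real (N i))
          = real_of_int (- (?s div int (N i)) * \<phi> z i)"
        unfolding mult[OF xyz(1,2) i] * using N[OF i] by (simp add: field_simps)
    qed
    also have "\<dots> \<in> \<int>" by (intro Ints_sum Ints_of_int)
    finally show "coord_pairing l N (\<phi> (x \<otimes>\<^bsub>G\<^esub> y)) (\<phi> z)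
        - (coord_pairing l N (\<phi> x) (\<phi> z) + coord_pairing l N (\<phi> y) (\<phi> z)) \<in> \<int>" .
  next
    fix x assume x: "x \<in> carrier G"
      and int: "\<forall>y\<in>carrier G. coord_pairing l N (\<phi> x) (\<phi> y) \<in> \<int>"
    have px: "\<phi> x \<in> carrier ?P" using bij x bij_betwE by blast
    have zero: "\<phi> x i = 0" if i: "i \<in> {1..l}" for i
    proof -
      \<comment> \<open>Pairing with the \<open>i\<close>-th unit vector isolates
        \<open>\<phi> x i / N i\<close>; if that is an integer, a coordinate in
        \<open>{0..<N i}\<close> must be 0.\<close>
      define e where "e = (\<lambda>j\<in>{1..l}. if j = i then 1 else (0::int))"
      have "e \<in> carrier ?P"
        using N by (auto simp: e_def carrier_integer_mod_group)
      then obtain y where y: "y \<in> carrier G" "\<phi> y = e"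
        using bij by (metis bij_betw_def imageE)
      have "coord_pairing l N (\<phi> x) e = (\<Sum>j=1..l. if j = i then real_of_int (\<phi> x i) / N i else 0)"
        unfolding coord_pairing_def by (intro sum.cong) (auto simp: e_def)
      also have "\<dots> = real_of_int (\<phi> x i) / N i" using i by simp
      finally have "real_of_int (\<phi> x i) / N i \<in> \<int>" using int y by metis
      then obtain m where "real_of_int (\<phi> x i) / N i = of_int m" by (elim Ints_cases)
      then have "real_of_int (\<phi> x i) = real_of_int (m * int (N i))"
        using N[OF i] by (simp add: field_simps)
      then have eq: "\<phi> x i = m * int (N i)" by linarith
      moreover have "\<phi> x i \<in> {0..<int (N i)}"
        using PiE_mem[OF px[unfolded carrier_product_group] i] N[OF i]
        by (simp add: carrier_integer_mod_group split: if_splits)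
      ultimately show ?thesis
        by (metis atLeastLessThan_iff mod_mult_self2_is_0 mod_pos_pos_trivial)
    qed
    have "\<phi> x = \<one>\<^bsub>?P\<^esub>"
    proof (rule PiE_ext)
      show "\<phi> x \<in> Pi\<^sub>E {1..l} (\<lambda>i. carrier (integer_mod_group (N i)))" using px by simp
      show "\<one>\<^bsub>?P\<^esub> \<in> Pi\<^sub>E {1..l} (\<lambda>i. carrier (integer_mod_group (N i)))" by auto
    qed (use zero in auto)
    moreover have "\<phi> \<one>\<^bsub>G\<^esub> = \<one>\<^bsub>?P\<^esub>" using hom by (intro hom_one) auto
    ultimately show "x = \<one>\<^bsub>G\<^esub>"
      using bij x by (metis bij_betw_def inj_onD one_closed)
  qed
qed

subsection \<open>The failure probability\<close>

text \<open>Markov's inequality for the number of events \<open>E x\<close> that occur: it is at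
  least \<open>c\<close> on \<open>U\<close>, and its expectation is the sum of the
  probabilities.\<close>

lemma (in prob_space) card_times_prob_le_sum:
  assumes X: "finite X" and E: "\<And>x. x \<in> X \<Longrightarrow> E x \<in> events" and U: "U \<in> events"
    and c: "\<And>\<omega>. \<omega> \<in> U \<Longrightarrow> c \<le> card {x \<in> X. \<omega> \<in> E x}"
  shows "real c * prob U \<le> (\<Sum>x\<in>X. prob (E x))"
proof -
  have "real c * prob U = expectation (\<lambda>\<omega>. real c * indicator U \<omega>)"
    using U by simp
  also have "\<dots> \<le> expectation (\<lambda>\<omega>. \<Sum>x\<in>X. indicator (E x) \<omega>)"
  proof (rule integral_mono)
    show "integrable M (\<lambda>\<omega>. real c * indicator U \<omega>)"
      using U by (auto simp: emeasure_eq_measure)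
    show "integrable M (\<lambda>\<omega>. \<Sum>x\<in>X. indicator (E x) \<omega> :: real)"
      using E by (auto simp: emeasure_eq_measure)
    show "real c * indicator U \<omega> \<le> (\<Sum>x\<in>X. indicator (E x) \<omega>)" for \<omega>
    proof -
      have "(\<Sum>x\<in>X. indicator (E x) \<omega> :: real) = card {x \<in> X. \<omega> \<in> E x}"
        using X by (simp add: indicator_def sum.If_cases Int_def)
      then show ?thesis using c[of \<omega>] by (auto simp: indicator_def)
    qed
  qed
  also have "\<dots> = (\<Sum>x\<in>X. prob (E x))"
    using E by (subst Bochner_Integration.integral_sum) (auto simp: emeasure_eq_measure)
  finally show ?thesis .
qed

lemma (in prob_space) prob_indep_uniform_all_mem:
  assumes indep: "indep_vars (\<lambda>_. count_space UNIV) t I" and I: "finite I"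
    and dist: "\<And>i. i \<in> I \<Longrightarrow> distr M (count_space UNIV) (t i) = measure_pmf (pmf_of_set K)"
    and K: "finite K" "K \<noteq> {}"
  shows "prob {\<omega> \<in> space M. \<forall>i\<in>I. t i \<omega> \<in> D} = (card (K \<inter> D) / card K) ^ card I"
proof (cases "I = {}")
  case True
  then show ?thesis by (simp add: prob_space)
next
  case False
  have "{\<omega> \<in> space M. \<forall>i\<in>I. t i \<omega> \<in> D} = (\<Inter>i\<in>I. t i -` D \<inter> space M)"
    using False by auto
  then have "prob {\<omega> \<in> space M. \<forall>i\<in>I. t i \<omega> \<in> D} = (\<Prod>i\<in>I. prob (t i -` D \<inter> space M))"
    using indep_varsD_finite[OF indep False I, of "\<lambda>_. D"] by simp
  also have "\<dots> = (\<Prod>i\<in>I. card (K \<inter> D) / card K)"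
  proof (rule prod.cong[OF refl])
    fix i assume i: "i \<in> I"
    have "t i \<in> measurable M (count_space UNIV)"
      using indep i by (auto simp: indep_vars_def)
    then have "prob (t i -` D \<inter> space M) = measure (distr M (count_space UNIV) (t i)) D"
      by (subst measure_distr) auto
    also have "\<dots> = card (K \<inter> D) / card K"
      unfolding dist[OF i] using K by (simp add: measure_pmf_of_set)
    finally show "prob (t i -` D \<inter> space M) = card (K \<inter> D) / card K" .
  qed
  finally show ?thesis by simp
qed

lemma events_all_mem:
  assumes "finite I" "\<And>i. i \<in> I \<Longrightarrow> t i \<in> measurable M (count_space UNIV)"
  shows "{\<omega> \<in> space M. \<forall>i\<in>I. t i \<omega> \<in> D} \<in> sets M"
proof -
  have "{\<omega> \<in> space M. t i \<omega> \<in> D} \<in> sets M" if "i \<in> I" for i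
    using measurable_sets[OF assms(2)[OF that], of D] by (simp add: vimage_def Int_def conj_commute)
  then show ?thesis using assms(1) by (intro sets.sets_Collect_finite_All)
qed

section \<open>Numerical estimates behind the two bounds on \<open>k\<close>\<close>

lemma sum_inverse_consecutive_le_1:
  assumes "finite P" "\<And>p. p \<in> P \<Longrightarrow> p \<ge> (2::nat)"
  shows "(\<Sum>p\<in>P. 1 / (real p * (real p - 1))) \<le> 1"
proof -
  \<comment> \<open>Telescoping: each term is \<open>1 / (p - 1) - 1 / p\<close>. The upper end
    \<open>Suc m\<close> makes \<open>m = 0\<close> the empty sum.\<close>
  have eq: "(\<Sum>p\<in>{2..Suc m}. 1 / (real p * (real p - 1))) = 1 - 1 / real (Suc m)" for m
  proof (induction m)
    case (Suc m)
    have "(\<Sum>p\<in>{2..Suc (Suc m)}. 1 / (real p * (real p - 1)))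
        = (\<Sum>p\<in>{2..Suc m}. 1 / (real p * (real p - 1))) + 1 / (real (Suc (Suc m)) * real (Suc m))"
      by simp
    also have "\<dots> = 1 - 1 / real (Suc (Suc m))"
    proof -
      have "1 - 1 / a + 1 / ((a + 1) * a) = 1 - 1 / (a + 1)" if "a > 0" for a :: real
        using that by (simp add: divide_simps) (simp add: algebra_simps)
      from this[of "real (Suc m)"] show ?thesis unfolding Suc.IH by (simp add: add_ac)
    qed
    finally show ?case .
  qed simp
  obtain m where "P \<subseteq> {..m}" using finite_nat_iff_bounded_le[of P] assms(1) by blast
  then have "P \<subseteq> {2..Suc m}" using assms(2) by force
  then have "(\<Sum>p\<in>P. 1 / (real p * (real p - 1))) \<le> (\<Sum>p\<in>{2..Suc m}. 1 / (real p * (real p - 1)))"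
    by (intro sum_mono2) auto
  also have "\<dots> \<le> 1" unfolding eq by simp
  finally show ?thesis .
qed

text \<open>The geometric sum is at most \<open>p ^ n / (p - 1)\<close>. One of the
  \<open>k - n\<close> spare factors \<open>p\<close> turns this into
  \<open>1 / (p * (p - 1))\<close>, whose sum over \<open>P\<close> is at most 1; the other factors
  are estimated by 2. The factor spent on convergence is the 2 in the numerator.\<close>

lemma sum_geometric_prime_le:
  assumes P: "finite P" "\<And>p. p \<in> P \<Longrightarrow> p \<ge> (2::nat)" and r: "\<And>p. p \<in> P \<Longrightarrow> r p \<le> n" and nk: "n < k"
  shows "(\<Sum>p\<in>P. (\<Sum>j<r p. real p ^ j) / real p ^ k) \<le> 2 / 2 ^ (k - n)"
proof -
  define m where "m = k - n - 1"
  have k: "k = n + Suc m" using nk by (simp add: m_def)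
  have "(\<Sum>j<r p. real p ^ j) / real p ^ k \<le> 1 / (real p * (real p - 1)) * (1 / 2 ^ m)" if p: "p \<in> P" for p
  proof -
    have p2: "real p \<ge> 2" using P(2)[OF p] by simp
    have "(\<Sum>j<r p. real p ^ j) = (real p ^ r p - 1) / (real p - 1)"
      using p2 by (simp add: power_diff_1_eq)
    also have "\<dots> \<le> real p ^ n / (real p - 1)"
    proof (rule divide_right_mono)
      show "real p ^ r p - 1 \<le> real p ^ n"
        using p2 power_increasing[OF r[OF p], of "real p"] by linarith
    qed (use p2 in simp)
    finally have "(\<Sum>j<r p. real p ^ j) / real p ^ k \<le> real p ^ n / (real p - 1) / real p ^ k"
      by (rule divide_right_mono) simp
    also have "\<dots> = 1 / (real p * (real p - 1)) * (1 / real p ^ m)"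
      using p2 by (simp add: k power_add field_simps)
    also have "\<dots> \<le> 1 / (real p * (real p - 1)) * (1 / 2 ^ m)"
      using p2 by (intro mult_left_mono divide_left_mono power_mono) auto
    finally show ?thesis .
  qed
  then have "(\<Sum>p\<in>P. (\<Sum>j<r p. real p ^ j) / real p ^ k) \<le> (\<Sum>p\<in>P. 1 / (real p * (real p - 1)) * (1 / 2 ^ m))"
    by (rule sum_mono)
  also have "\<dots> = (\<Sum>p\<in>P. 1 / (real p * (real p - 1))) * (1 / 2 ^ m)"
    by (rule sum_distrib_right[symmetric])
  also have "\<dots> \<le> 1 * (1 / 2 ^ m)"
    using sum_inverse_consecutive_le_1[OF P] by (intro mult_right_mono) auto
  finally show ?thesis by (simp add: k)
qed

text \<open>Induction on \<open>P\<close>; the step is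
  \<open>(2 ^ a - 1) * (2 ^ b - 1) \<ge> 0\<close> multiplied out.\<close>

lemma sum_pow2_minus_1_le:
  assumes "finite P"
  shows "(\<Sum>p\<in>P. (2::real) ^ r p - 1) \<le> 2 ^ (\<Sum>p\<in>P. r p) - 1"
  using assms
proof (induction P rule: finite_induct)
  case (insert p P)
  have "0 \<le> ((2::real) ^ r p - 1) * (2 ^ (\<Sum>p\<in>P. r p) - 1)" by (intro mult_nonneg_nonneg) auto
  then show ?case using insert by (simp add: power_add algebra_simps)
qed simp

text \<open>Since \<open>j < r p \<le> k\<close>, the quotient \<open>p ^ j / p ^ k\<close> is
  largest at \<open>p = 2\<close>. The resulting sums combine into a single power of 2 by
  \<open>sum_pow2_minus_1_le\<close>, so no factor 2 is lost.\<close>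

lemma sum_geometric_chain_le:
  assumes P: "finite P" "\<And>p. p \<in> P \<Longrightarrow> p \<ge> (2::nat)" and n: "(\<Sum>p\<in>P. r p) \<le> n" and nk: "n \<le> k"
  shows "(\<Sum>p\<in>P. (\<Sum>j<r p. real p ^ j) / real p ^ k) \<le> 1 / 2 ^ (k - n)"
proof -
  have "(\<Sum>j<r p. real p ^ j) / real p ^ k \<le> (2 ^ r p - 1) / 2 ^ k" if p: "p \<in> P" for p
  proof -
    have p2: "real p \<ge> 2" using P(2)[OF p] by simp
    have rk: "r p \<le> k" using member_le_sum[OF p, of r] P n nk by fastforce
    have "real p ^ j / real p ^ k \<le> 2 ^ j / 2 ^ k" if "j < r p" for j
    proof -
      have "k = j + (k - j)" using that rk by simp
      then have "x ^ j / x ^ k = 1 / x ^ (k - j)" if "x > 0" for x :: real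
        using that by (metis nonzero_divide_mult_cancel_left power_add power_not_zero less_irrefl)
      moreover have "1 / real p ^ (k - j) \<le> 1 / 2 ^ (k - j)"
        using p2 by (intro divide_left_mono power_mono) auto
      ultimately show ?thesis using p2 by simp
    qed
    then have "(\<Sum>j<r p. real p ^ j / real p ^ k) \<le> (\<Sum>j<r p. 2 ^ j / 2 ^ k)" by (intro sum_mono) auto
    also have "\<dots> = (\<Sum>j<r p. 2 ^ j) / 2 ^ k" by (simp add: sum_divide_distrib)
    also have "\<dots> = (2 ^ r p - 1) / 2 ^ k" using power_diff_1_eq[of "2::real" "r p"] by simp
    finally show ?thesis by (simp add: sum_divide_distrib)
  qed
  then have "(\<Sum>p\<in>P. (\<Sum>j<r p. real p ^ j) / real p ^ k) \<le> (\<Sum>p\<in>P. (2 ^ r p - 1) / 2 ^ k)"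
    by (rule sum_mono)
  also have "\<dots> = (\<Sum>p\<in>P. 2 ^ r p - 1) / 2 ^ k" by (simp add: sum_divide_distrib)
  also have "\<dots> \<le> (2 ^ (\<Sum>p\<in>P. r p) - 1) / 2 ^ k"
    using sum_pow2_minus_1_le[OF P(1)] by (intro divide_right_mono) auto
  also have "\<dots> \<le> 2 ^ n / 2 ^ k"
  proof (rule divide_right_mono)
    show "(2::real) ^ (\<Sum>p\<in>P. r p) - 1 \<le> 2 ^ n"
      using power_increasing[OF n, of "2::real"] by linarith
  qed simp
  also have "\<dots> = 1 / 2 ^ (k - n)" using nk by (simp add: power_diff)
  finally show ?thesis .
qed

text \<open>\<open>y > 1\<close> makes the logarithm positive; the resulting \<open>n < k\<close>
  gives the truncated subtraction \<open>k - n\<close> its true value.\<close>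

lemma pow2_ge_of_ceiling_log:
  assumes "int k \<ge> int n + \<lceil>log 2 y\<rceil>" "y > 1"
  shows "n < k" "2 ^ (k - n) \<ge> y"
proof -
  have "log 2 y > 0" using assms(2) by simp
  have *: "log 2 y \<le> real k - real n" using assms(1) by linarith
  with \<open>log 2 y > 0\<close> show nk: "n < k" by simp
  have "y = 2 powr log 2 y" using assms(2) by simp
  also have "\<dots> \<le> 2 powr (real k - real n)" using * by (intro powr_mono) auto
  also have "\<dots> = 2 ^ (k - n)" using nk by (simp add: powr_realpow flip: of_nat_diff)
  finally show "2 ^ (k - n) \<ge> y" .
qed

section \<open>Union bound over the primes dividing the index of \<open>H\<close>\<close>

context finite_pairing
begin

text \<open>Markov's inequality is applied to elements \<open>x\<close> rather than cosets: there
  are \<open>(p ^ r - 1) * card H\<close> of them, each event has probability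
  \<open>1 / p ^ card I\<close>, and if one occurs, so do at least \<open>(p - 1) * card H\<close>.
  The factor \<open>card H\<close> cancels.\<close>

lemma prob_exists_pth_root_le:
  assumes M: "prob_space M" and indep: "prob_space.indep_vars M (\<lambda>_. count_space UNIV) t I"
    and I: "finite I"
    and dist: "\<And>i. i \<in> I \<Longrightarrow> distr M (count_space UNIV) (t i) = measure_pmf (pmf_of_set (perp H))"
    and H: "subgroup H G" and p: "prime p" and r: "card (pth_roots H p) = p ^ r * card H"
  shows "measure M (\<Union>x\<in>pth_roots H p - H. {\<omega> \<in> space M. \<forall>i\<in>I. t i \<omega> \<in> perp (adjoin H x)})
           \<le> (\<Sum>j<r. real p ^ j) / real p ^ card I"
proof -
  interpret prob_space M by fact
  let ?X = "pth_roots H p - H"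
  let ?E = "\<lambda>x. {\<omega> \<in> space M. \<forall>i\<in>I. t i \<omega> \<in> perp (adjoin H x)}"
  let ?U = "\<Union>x\<in>?X. ?E x"
  have Hpos: "card H > 0" by (rule card_subgroup_pos[OF fin H])
  have finH: "finite H" using Hpos card_ge_0_finite by blast
  have finX: "finite (pth_roots H p)" using fin by (simp add: pth_roots_def)
  have finp: "finite (perp K)" for K using fin by (simp add: perp_def)
  have meas: "t i \<in> measurable M (count_space UNIV)" if "i \<in> I" for i
    using indep that by (auto simp: indep_vars_def)
  have Ev: "?E x \<in> events" for x by (rule events_all_mem[OF I meas])
  have Xc: "x \<in> carrier G" "x [^] p \<in> H" "x \<notin> H" if "x \<in> ?X" for x
    using that by (auto simp: pth_roots_def)
  have prob_E: "prob (?E x) = (1 / real p) ^ card I" if x: "x \<in> ?X" for x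
  proof -
    have eq: "perp H \<inter> perp (adjoin H x) = {s \<in> perp H. b s x \<in> \<int>}"
      unfolding perp_adjoin[OF H Xc(1)[OF x]] by blast
    have ne: "perp H \<noteq> {}"
      using subgroup.one_closed[OF subgroup_perp[OF subgroup.subset[OF H]]] by blast
    have "real p * card {s \<in> perp H. b s x \<in> \<int>} = card (perp H)"
      using card_perp_adjoin[OF H Xc(1,3,2)[OF x] p] by (metis of_nat_mult)
    moreover have "card (perp H) > 0" using ne finp by (simp add: card_gt_0_iff)
    ultimately have "card (perp H \<inter> perp (adjoin H x)) / card (perp H) = 1 / real p"
      unfolding eq using prime_gt_0_nat[OF p] by (simp add: field_simps)
    then show ?thesis
      using prob_indep_uniform_all_mem[OF indep I dist finp ne, of "perp (adjoin H x)"] by simp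
  qed
  have many: "(p - 1) * card H \<le> card {x \<in> ?X. \<omega> \<in> ?E x}" if w_U: "\<omega> \<in> ?U" for \<omega>
  proof -
    obtain x where x: "x \<in> ?X" and w: "\<omega> \<in> ?E x"
      using w_U by (rule UN_E)
    have sub: "adjoin H x \<subseteq> pth_roots H p"
      using adjoin_subset[OF H subgroup_pth_roots[OF H] subset_pth_roots[OF H]] x by blast
    \<comment> \<open>Samples orthogonal to \<open>adjoin H x\<close> are orthogonal to
      \<open>adjoin H y\<close> for each \<open>y\<close> in it, so every such \<open>y\<close>
      outside \<open>H\<close> is counted.\<close>
    have "adjoin H x - H \<subseteq> {x \<in> ?X. \<omega> \<in> ?E x}"
    proof
      fix y assume y: "y \<in> adjoin H x - H"
      have "adjoin H y \<subseteq> adjoin H x"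
        using y Xc(1)[OF x] by (intro adjoin_subset H subgroup_adjoin subset_adjoin) auto
      then have "perp (adjoin H x) \<subseteq> perp (adjoin H y)" by (auto simp: perp_def)
      then show "y \<in> {x \<in> ?X. \<omega> \<in> ?E x}" using w y sub by blast
    qed
    then have "card (adjoin H x - H) \<le> card {x \<in> ?X. \<omega> \<in> ?E x}"
      using finX by (intro card_mono) auto
    moreover have "card (adjoin H x - H) = (p - 1) * card H"
      using card_Diff_subset[OF finH subset_adjoin[OF H Xc(1)[OF x]]]
        card_adjoin[OF fin H Xc(1)[OF x] p Xc(2,3)[OF x]] by (simp add: diff_mult_distrib)
    ultimately show ?thesis by simp
  qed
  have "real ((p - 1) * card H) * prob ?U \<le> (\<Sum>x\<in>?X. prob (?E x))"
    using finX Ev many by (intro card_times_prob_le_sum sets.finite_UN) auto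
  also have "\<dots> = card ?X * (1 / real p) ^ card I" using prob_E by simp
  also have "card ?X = (real p ^ r - 1) * card H"
    using card_Diff_subset[OF finH subset_pth_roots[OF H]] prime_ge_1_nat[OF p]
    by (simp add: r of_nat_diff algebra_simps)
  also have "(real p ^ r - 1) = (real p - 1) * (\<Sum>j<r. real p ^ j)" by (rule power_diff_1_eq)
  finally have "((real p - 1) * card H) * prob ?U
      \<le> ((real p - 1) * card H) * ((\<Sum>j<r. real p ^ j) / real p ^ card I)"
    using prime_ge_1_nat[OF p] by (simp add: of_nat_diff power_divide ac_simps)
  moreover have "(real p - 1) * card H > 0" using prime_gt_1_nat[OF p] Hpos by simp
  ultimately show ?thesis by (rule mult_left_le_imp_le)
qed

lemma index_decomposition:
  assumes "subgroup H G"
  shows "Coset.order G = card H * (Coset.order G div card H)" "Coset.order G div card H > 0"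
proof -
  show eq: "Coset.order G = card H * (Coset.order G div card H)"
    using card_subgroup_dvd_order[OF fin assms] by simp
  have "Coset.order G > 0" using fin by (simp add: order_gt_0_iff_finite)
  with eq show "Coset.order G div card H > 0" by (metis gr0I mult_0_right less_irrefl)
qed

lemma prob_annihilator_eq_ge:
  assumes M: "prob_space M" and indep: "prob_space.indep_vars M (\<lambda>_. count_space UNIV) t I"
    and I: "finite I"
    and dist: "\<And>i. i \<in> I \<Longrightarrow> distr M (count_space UNIV) (t i) = measure_pmf (pmf_of_set (perp H))"
    and H: "subgroup H G"
    and r: "\<And>p. p \<in> prime_factors (Coset.order G div card H) \<Longrightarrow> card (pth_roots H p) = p ^ r p * card H"
  shows "measure M {\<omega> \<in> space M. {x \<in> carrier G. \<forall>i\<in>I. b (t i \<omega>) x \<in> \<int>} = H}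
     \<ge> 1 - (\<Sum>p\<in>prime_factors (Coset.order G div card H). (\<Sum>j<r p. real p ^ j) / real p ^ card I)"
proof -
  interpret prob_space M by fact
  let ?A = "\<lambda>\<omega>. {x \<in> carrier G. \<forall>i\<in>I. b (t i \<omega>) x \<in> \<int>}"
  let ?S = "{\<omega> \<in> space M. ?A \<omega> = H}"
  let ?P = "prime_factors (Coset.order G div card H)"
  let ?U = "\<lambda>p. \<Union>x\<in>pth_roots H p - H. {\<omega> \<in> space M. \<forall>i\<in>I. t i \<omega> \<in> perp (adjoin H x)}"
  \<comment> \<open>The samples lie in \<open>perp H\<close> only almost surely, so the null event
    outside \<open>?Q\<close> is carried separately.\<close>
  let ?Q = "{\<omega> \<in> space M. \<forall>i\<in>I. t i \<omega> \<in> perp H}"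
  note Hc = subgroup.mem_carrier[OF H]
  have finp: "finite (perp K)" for K using fin by (simp add: perp_def)
  have meas: "t i \<in> measurable M (count_space UNIV)" if "i \<in> I" for i
    using indep that by (auto simp: indep_vars_def)
  have ne: "perp H \<noteq> {}"
    using subgroup.one_closed[OF subgroup_perp[OF subgroup.subset[OF H]]] by blast
  then have "card (perp H) > 0" using finp by (simp add: card_gt_0_iff)
  then have Q1: "prob ?Q = 1"
    using prob_indep_uniform_all_mem[OF indep I dist finp ne, of "perp H"] by simp
  have Qev: "?Q \<in> events" by (rule events_all_mem[OF I meas])
  have Uev: "?U p \<in> events" for p
    using fin by (intro sets.finite_UN events_all_mem[OF I meas]) (auto simp: pth_roots_def)
  have Sev: "?S \<in> events"
  proof -
    \<comment> \<open>Testing each \<open>x\<close> of the finite carrier separately turns the event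
      into a finite intersection of measurable ones.\<close>
    have "?S = {\<omega> \<in> space M. \<forall>x\<in>carrier G. x \<in> H \<longleftrightarrow> (\<forall>i\<in>I. t i \<omega> \<in> {s. b s x \<in> \<int>})}"
      using Hc by auto
    also have "\<dots> \<in> events"
    proof (rule sets.sets_Collect_finite_All[OF _ fin])
      fix x
      have ev: "{\<omega> \<in> space M. \<forall>i\<in>I. t i \<omega> \<in> {s. b s x \<in> \<int>}} \<in> events"
        by (rule events_all_mem[OF I meas])
      then show "{\<omega> \<in> space M. x \<in> H \<longleftrightarrow> (\<forall>i\<in>I. t i \<omega> \<in> {s. b s x \<in> \<int>})} \<in> events"
        using sets.sets_Collect_neg[OF ev] by (cases "x \<in> H") auto
    qed
    finally show ?thesis .
  qed
  have cover: "space M - ?S \<subseteq> (space M - ?Q) \<union> (\<Union>p\<in>?P. ?U p)"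
  proof
    fix \<omega> assume w: "\<omega> \<in> space M - ?S"
    show "\<omega> \<in> (space M - ?Q) \<union> (\<Union>p\<in>?P. ?U p)"
    proof (cases "\<omega> \<in> ?Q")
      case False
      then show ?thesis using w by blast
    next
      case True
      then have tp: "t i \<omega> \<in> perp H" if "i \<in> I" for i using that by blast
      have sgA: "subgroup (?A \<omega>) G"
      proof -
        have "?A \<omega> = {x \<in> carrier G. \<forall>s\<in>(\<lambda>i. t i \<omega>) ` I. b x s \<in> \<int>}"
          by (auto simp: pairing_sym)
        also have "subgroup \<dots> G" using tp by (intro subgroup_annihilator) (auto simp: perp_def)
        finally show ?thesis .
      qed
      have "H \<subseteq> ?A \<omega>" using tp Hc by (auto simp: perp_def)
      moreover have "?A \<omega> \<noteq> H" using w by blast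
      ultimately obtain y where y: "y \<in> ?A \<omega>" "y \<notin> H" by blast
      obtain p :: nat and x where x: "prime p" "x \<in> ?A \<omega>" "x \<notin> H" "x [^] p \<in> H"
        by (rule exists_prime_pow_mem[OF fin H sgA y])
      have xc: "x \<in> carrier G" using x(2) by blast
      \<comment> \<open>The left side is the order of \<open>adjoin H x\<close>, so Lagrange puts
        \<open>p\<close> among the prime factors of the index and the union bound runs over these
        only.\<close>
      have "p * card H dvd Coset.order G"
        using card_subgroup_dvd_order[OF fin subgroup_adjoin[OF H xc]] card_adjoin[OF fin H xc x(1,4,3)]
        by simp
      then have "p dvd Coset.order G div card H"
        by (subst (asm) index_decomposition(1)[OF H])
          (use card_subgroup_pos[OF fin H] in \<open>simp add: mult.commute[of p]\<close>)
      then have "p \<in> ?P" using x(1) index_decomposition(2)[OF H] by (simp add: prime_factors_dvd)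
      moreover have "x \<in> pth_roots H p - H" using x xc by (simp add: pth_roots_def)
      moreover have "t i \<omega> \<in> perp (adjoin H x)" if "i \<in> I" for i
        using tp[OF that] x(2) that by (simp add: perp_adjoin[OF H xc])
      ultimately show ?thesis using w by blast
    qed
  qed
  have QQ: "space M - ?Q \<in> events" using Qev by (rule sets.compl_sets)
  have UU: "(\<Union>p\<in>?P. ?U p) \<in> events" using Uev by (rule sets.finite_UN[rotated]) simp
  have "prob (space M - ?S) \<le> prob ((space M - ?Q) \<union> (\<Union>p\<in>?P. ?U p))"
    by (intro finite_measure_mono cover sets.Un QQ UU)
  also have "\<dots> \<le> prob (space M - ?Q) + prob (\<Union>p\<in>?P. ?U p)"
    by (intro measure_Un_le QQ UU)
  also have "prob (space M - ?Q) = 0" using Q1 prob_compl[OF Qev] by simp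
  also have "prob (\<Union>p\<in>?P. ?U p) \<le> (\<Sum>p\<in>?P. prob (?U p))"
    using Uev by (intro finite_measure_subadditive_finite) auto
  also have "\<dots> \<le> (\<Sum>p\<in>?P. (\<Sum>j<r p. real p ^ j) / real p ^ card I)"
    by (intro sum_mono prob_exists_pth_root_le[OF M indep I dist H _ r]) auto
  finally show ?thesis using prob_compl[OF Sev] by simp
qed

end

section \<open>Either bound on \<open>k\<close> pushes the union bound below
  \<open>\<epsilon>\<close>\<close>

theorem theorem5:
  fixes G :: "('a, 'b) monoid_scheme"
    and l :: nat and N :: "nat \<Rightarrow> nat" and \<phi> :: "'a \<Rightarrow> nat \<Rightarrow> int"
    and H :: "'a set" and S :: "'s set" and f :: "'a \<Rightarrow> 's"
    and \<epsilon> :: real and k :: nat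
    and M :: "'w measure" and t :: "nat \<Rightarrow> 'w \<Rightarrow> 'a"
  assumes "comm_group G" and "finite (carrier G)"
    and "prime_power_decomposition G l N \<phi>"
    and "subgroup H G" and "hides_subgroup G H S f"
    and "0 < \<epsilon>" and "\<epsilon> < 1"
    and "prob_space M"
    and "prob_space.indep_vars M (\<lambda>_. count_space UNIV) t {1..k}"
    and "\<And>i. i \<in> {1..k} \<Longrightarrow>
           distr M (count_space UNIV) (t i) = measure_pmf (pmf_of_set (orthogonal_subgroup G l N \<phi> H))"
    and "int k \<ge> int (group_rank G) + \<lceil>log 2 (2 / \<epsilon>)\<rceil> \<or>
         int k \<ge> int (chain_length G) - int (chain_length (G\<lparr>carrier := H\<rparr>)) + \<lceil>log 2 (1 / \<epsilon>)\<rceil>"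
  shows "measure M {\<omega> \<in> space M. solution_subgroup G l N \<phi> k (\<lambda>i. t i \<omega>) = H} \<ge> 1 - \<epsilon>"
proof -
  note H = assms(4)
  interpret finite_pairing G "\<lambda>x y. coord_pairing l N (\<phi> x) (\<phi> y)"
    by (rule finite_pairing_coord[OF assms(1-3)])
  have perp: "orthogonal_subgroup G l N \<phi> H = perp H"
    by (simp add: orthogonal_subgroup_def perp_def)
  define n where "n = Coset.order G div card H"
  define P where "P = prime_factors n"
  have P: "finite P" "\<And>p. p \<in> P \<Longrightarrow> p \<ge> 2"
    by (auto simp: P_def dest: in_prime_factors_imp_prime prime_ge_2_nat)
  note ind = index_decomposition[OF H, folded n_def]
  have "\<forall>p\<in>P. \<exists>r. card (pth_roots H p) = p ^ r * card H"
    using card_pth_roots[OF fin H] by (auto simp: P_def)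
  then obtain r where r: "\<And>p. p \<in> P \<Longrightarrow> card (pth_roots H p) = p ^ r p * card H"
    by metis
  have Hpos: "card H > 0" by (rule card_subgroup_pos[OF fin H])
  have r_rank: "r p \<le> group_rank G" if p: "p \<in> P" for p
  proof -
    have "p ^ r p * card H \<le> p ^ group_rank G * card H"
      using card_pth_roots_le_rank[OF fin H, of p] P(2)[OF p] r[OF p] by simp
    then have "p ^ r p \<le> p ^ group_rank G" using Hpos by simp
    with P(2)[OF p] show ?thesis by simp
  qed
  \<comment> \<open>\<open>pth_roots H p\<close> is a subgroup of order
    \<open>p ^ r p * card H\<close>, so \<open>p ^ r p\<close> divides the index
    \<open>n\<close>.\<close>
  have r_mult: "r p \<le> count (prime_factorization n) p" if p: "p \<in> P" for p
  proof -
    have pr: "prime p" using p by (auto simp: P_def)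
    have "card (pth_roots H p) dvd Coset.order G"
      by (rule card_subgroup_dvd_order[OF fin subgroup_pth_roots[OF H]])
    then have "p ^ r p * card H dvd n * card H" using r[OF p] ind(1) by (simp add: mult.commute)
    then have "p ^ r p dvd n" using Hpos by simp
    then have "r p \<le> multiplicity p n"
      using pr ind(2) by (intro multiplicity_geI) (auto simp: prime_gt_1_nat)
    then show ?thesis using pr by (simp add: count_prime_factorization_prime)
  qed
  have "(\<Sum>p\<in>P. (\<Sum>j<r p. real p ^ j) / real p ^ k) \<le> \<epsilon>"
    using assms(11)
  proof
    assume "int k \<ge> int (group_rank G) + \<lceil>log 2 (2 / \<epsilon>)\<rceil>"
    moreover have "2 / \<epsilon> > 1" using assms(6,7) by simp
    ultimately have k: "group_rank G < k" "2 ^ (k - group_rank G) \<ge> 2 / \<epsilon>"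
      by (rule pow2_ge_of_ceiling_log)+
    have "(\<Sum>p\<in>P. (\<Sum>j<r p. real p ^ j) / real p ^ k) \<le> 2 / 2 ^ (k - group_rank G)"
      by (rule sum_geometric_prime_le[OF P r_rank k(1)])
    also have "\<dots> \<le> \<epsilon>" using k(2) assms(6) by (simp add: field_simps)
    finally show ?thesis .
  next
    let ?n = "size (prime_factorization n)"
    assume "int k \<ge> int (chain_length G) - int (chain_length (G\<lparr>carrier := H\<rparr>)) + \<lceil>log 2 (1 / \<epsilon>)\<rceil>"
    then have "int k \<ge> int ?n + \<lceil>log 2 (1 / \<epsilon>)\<rceil>"
      using chain_length_diff[OF fin H] by (simp add: n_def)
    moreover have "1 / \<epsilon> > 1" using assms(6,7) by simp
    ultimately have k: "?n < k" "2 ^ (k - ?n) \<ge> 1 / \<epsilon>"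
      by (rule pow2_ge_of_ceiling_log)+
    \<comment> \<open>Over the distinct primes the multiplicities add up to the number of prime
      factors of the index.\<close>
    have le: "(\<Sum>p\<in>P. r p) \<le> ?n"
      unfolding size_multiset_overloaded_eq P_def[symmetric] by (intro sum_mono r_mult)
    have "(\<Sum>p\<in>P. (\<Sum>j<r p. real p ^ j) / real p ^ k) \<le> 1 / 2 ^ (k - ?n)"
      by (rule sum_geometric_chain_le[OF P le less_imp_le[OF k(1)]])
    also have "\<dots> \<le> \<epsilon>" using k(2) assms(6) by (simp add: field_simps)
    finally show ?thesis .
  qed
  moreover have "measure M {\<omega> \<in> space M. solution_subgroup G l N \<phi> k (\<lambda>i. t i \<omega>) = H}
      \<ge> 1 - (\<Sum>p\<in>P. (\<Sum>j<r p. real p ^ j) / real p ^ k)"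
    using prob_annihilator_eq_ge[OF assms(8,9) _ assms(10)[unfolded perp] H r[unfolded P_def n_def]]
    by (simp add: solution_subgroup_def P_def n_def)
  ultimately show ?thesis by linarith
qed

end
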